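(* Let $A,B\in\mathbb{C}_{n,n}$ with $\mathrm{Ind}(A)=k$, $\mathrm{Ind}(B)=t$, $\mathrm{rk}(A^{k})=\mathrm{rk}\big((A^{k})^{\sim}A^{k}\big)=r$ and $\mathrm{rk}(B^{t})=\mathrm{rk}\big((B^{t})^{\sim}B^{t}\big)=s\ge r$. Then $$A\overset{(\mathrm{E})}{\leq}B\iff A^{k+1}=BA^{k}\ \text{ and }\ A^{\sim}A^{k}=B^{\sim}A^{k}.$$
   Context: $\mathbb{C}_{n,n}$ is the set of $n\times n$ complex matrices; $A^*$, $\mathrm{rk}(A)$, $\mathcal{R}(A)$ denote conjugate transpose, rank and column space. $\mathrm{Ind}(A)$ is the smallest positive integer $k$ with $\mathrm{rk}(A^{k+1})=\mathrm{rk}(A^k)$. The Minkowski metric matrix is $G=\begin{bmatrix}1&0\\ 0&-I_{n-1}\end{bmatrix}$ and the Minkowski adjoint of $A$ is $A^{\sim}=GA^*G$. For $A$ with $\mathrm{Ind}(A)=k$, the $\mathfrak{m}$-core-EP inverse $A^{(\mathrm{E})}$ of $A$ is the matrix $X\in\mathbb{C}_{n,n}$ (unique if it exists) satisfying $XAX=X$, $XA^{k+1}=A^k$, $(AX)^{\sim}=AX$ and $\mathcal{R}(X)\subseteq\mathcal{R}(A^k)$; it exists if and only if $\mathrm{rk}(A^k)=\mathrm{rk}((A^k)^{\sim}A^k)$. The $\mathfrak{m}$-core-EP order: for $A,B\in\mathbb{C}_{n,n}$ with $\mathrm{rk}(A^k)=\mathrm{rk}((A^k)^{\sim}A^k)$,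 $k=\mathrm{Ind}(A)$, write $A\overset{(\mathrm{E})}{\leq}B$ if $A^{(\mathrm{E})}A=A^{(\mathrm{E})}B$ and $AA^{(\mathrm{E})}=BA^{(\mathrm{E})}$. *)

theory Defs
  imports "Jordan_Normal_Form.Schur_Decomposition" "Jordan_Normal_Form.DL_Rank"
begin

(* Matrices are those of Jordan_Normal_Form. Since mat_adjoint conjugates the entries, it is the
   conjugate transpose on complex matrices. The first coordinate has index 0. *)

abbreviation rk :: "nat \<Rightarrow> complex mat \<Rightarrow> nat" where
  "rk n A \<equiv> vec_space.rank n A"

abbreviation col_range :: "nat \<Rightarrow> complex mat \<Rightarrow> complex vec set" where
  "col_range n A \<equiv> vec_space.col_space n A"

(* Starts at 1, so that an invertible matrix has index 1 (not 0). *)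
definition mat_index :: "nat \<Rightarrow> complex mat \<Rightarrow> nat" where
  "mat_index n A = (LEAST k. 1 \<le> k \<and> rk n (A ^\<^sub>m (k + 1)) = rk n (A ^\<^sub>m k))"

definition minkowski_metric :: "nat \<Rightarrow> complex mat" where
  "minkowski_metric n =
     mat n n (\<lambda>(i, j). if i = j then (if i = 0 then 1 else - 1) else 0)"

definition minkowski_adjoint :: "nat \<Rightarrow> complex mat \<Rightarrow> complex mat" where
  "minkowski_adjoint n A = minkowski_metric n * mat_adjoint A * minkowski_metric n"

definition is_m_core_EP_inverse :: "nat \<Rightarrow> complex mat \<Rightarrow> complex mat \<Rightarrow> bool" where
  "is_m_core_EP_inverse n A X \<longleftrightarrow>
     X \<in> carrier_mat n n \<and>
     X * A * X = X \<and>
     X * A ^\<^sub>m (mat_index n A + 1) = A ^\<^sub>m (mat_index n A) \<and>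
     minkowski_adjoint n (A * X) = A * X \<and>
     col_range n X \<subseteq> col_range n (A ^\<^sub>m (mat_index n A))"

(* Meaningful only if the inverse exists, i.e. if m_core_EP_rank_cond holds. *)
definition m_core_EP_inverse :: "nat \<Rightarrow> complex mat \<Rightarrow> complex mat" where
  "m_core_EP_inverse n A = (THE X. is_m_core_EP_inverse n A X)"

definition m_core_EP_rank_cond :: "nat \<Rightarrow> complex mat \<Rightarrow> bool" where
  "m_core_EP_rank_cond n A \<longleftrightarrow>
     rk n (A ^\<^sub>m (mat_index n A)) =
     rk n (minkowski_adjoint n (A ^\<^sub>m (mat_index n A)) * A ^\<^sub>m (mat_index n A))"

(* The order is only declared for A satisfying the rank condition, which therefore is part of
   the relation. *)
definition m_core_EP_le :: "nat \<Rightarrow> complex mat \<Rightarrow> complex mat \<Rightarrow> bool" where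
  "m_core_EP_le n A B \<longleftrightarrow>
     A \<in> carrier_mat n n \<and> B \<in> carrier_mat n n \<and> m_core_EP_rank_cond n A \<and>
     m_core_EP_inverse n A * A = m_core_EP_inverse n A * B \<and>
     A * m_core_EP_inverse n A = B * m_core_EP_inverse n A"

end

(* With P = A^k, the two rank conditions Ind(A) = k and rk(P~ P) = rk(P) turn into factorizations
   P = A P Z, P = W A P and P = M P~ P. They make Q = M P~ the Minkowski-orthogonal projector onto
   the range of P and X = P Z M~ the m-core-EP inverse of A, with A X = Q. Since X = P Y,
   the equation A P = B P is equivalent to A X = B X; and since A X is self-adjoint, X A = X B
   amounts to A~ (A X) = B~ (A X), hence to A~ P = B~ P. *)

theory Submission
  imports Defs
begin

section \<open>Column spaces, rank and factorizations\<close>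

context vec_space
begin

lemma col_space_closed:
  assumes "A \<in> carrier_mat n nc"
  shows "col_space A \<subseteq> carrier_vec n"
  using col_space_eq[OF assms] assms by auto

lemma cols_subset_col_space:
  assumes "A \<in> carrier_mat n nc"
  shows "set (cols A) \<subseteq> col_space A"
  unfolding col_space_def using cols_dim[of A] assms by (intro in_own_span) auto

text \<open>A maximal independent set of columns works: if some column were outside its span, that
  column could be adjoined, against maximality. The cardinality of such a maximal set is the
  rank.\<close>

lemma col_space_basis:
  assumes A: "A \<in> carrier_mat n nc"
  obtains U where "finite U" "U \<subseteq> set (cols A)" "lin_indpt U" "card U = rank A"
    "span U = col_space A"
proof -
  have cols: "set (cols A) \<subseteq> carrier_vec n"
    using A cols_dim by blast
  have "lin_indpt {}"
    by (meson empty_iff empty_subsetI finite_lin_indpt2 finite.emptyI)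
  then obtain U where fin: "finite U"
    and max: "maximal U (\<lambda>T. T \<subseteq> set (cols A) \<and> lin_indpt T)"
    using maximal_exists_superset[of "set (cols A)" "\<lambda>T. T \<subseteq> set (cols A) \<and> lin_indpt T" "{}"]
    by auto
  then have U: "U \<subseteq> set (cols A)" "lin_indpt U"
    by (auto simp: maximal_def)
  have Uc: "U \<subseteq> carrier_vec n"
    using U cols by blast
  have "set (cols A) \<subseteq> span U"
  proof
    fix v assume v: "v \<in> set (cols A)"
    show "v \<in> span U"
    proof (rule ccontr)
      assume nv: "v \<notin> span U"
      with v cols Uc U(2) have "lin_indpt (insert v U)"
        using lin_dep_iff_in_span[of U v] span_mem[of U v] by auto
      with max v U(1) have "insert v U = U"
        unfolding maximal_def by (metis insert_subset subset_insertI)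
      then show False
        using nv Uc in_own_span[of U] by auto
    qed
  qed
  then have "col_space A \<subseteq> span U"
    unfolding col_space_def using span_is_submodule[of U] Uc by (intro span_is_subset) auto
  moreover have "span U \<subseteq> col_space A"
    unfolding col_space_def using span_is_monotone U(1) by blast
  ultimately show thesis
    using that fin U rank_card_indpt[OF A max] by auto
qed

text \<open>The rank is the dimension of the column space taken as a vector space of its own, so
  independence is transferred to that subspace, where the dimension bounds it.\<close>

lemma lin_indpt_card_le_rank:
  assumes A: "A \<in> carrier_mat n nc" and S: "S \<subseteq> col_space A" "lin_indpt S"
  shows "card S \<le> rank A"
proof -
  have cols: "set (cols A) \<subseteq> carrier_vec n"
    using A cols_dim by blast
  have sub: "submodule class_ring (col_space A) V"
    unfolding col_space_def using span_is_submodule cols by auto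
  have vs: "vectorspace class_ring (vs (col_space A))"
    unfolding col_space_def using span_is_subspace[THEN subspace_is_vs] cols by auto
  have fd: "vectorspace.fin_dim class_ring (vs (col_space A))"
    unfolding col_space_def using fin_dim_span_cols[OF A] .
  have "LinearCombinations.module.lin_indpt class_ring (vs (col_space A)) S"
    using span_li_not_depend(2)[OF S(1) sub] S(2) by simp
  then show ?thesis
    using vectorspace.li_le_dim(2)[OF vs fd, of S] S(1) unfolding rank_def col_space_def by simp
qed

lemma rank_mono:
  assumes A: "A \<in> carrier_mat n nc" and B: "B \<in> carrier_mat n m"
    and sub: "col_space A \<subseteq> col_space B"
  shows "rank A \<le> rank B"
proof -
  obtain U where "U \<subseteq> set (cols A)" "lin_indpt U" "card U = rank A"
    using col_space_basis[OF A] .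
  then show ?thesis
    using lin_indpt_card_le_rank[OF B, of U] cols_subset_col_space[OF A] sub by auto
qed

text \<open>A vector of the larger space outside the smaller one, adjoined to a basis of the smaller
  one, would give \<open>rank A + 1\<close> independent vectors inside the column space of
  \<open>B\<close>.\<close>

lemma col_space_eqI:
  assumes A: "A \<in> carrier_mat n nc" and B: "B \<in> carrier_mat n m"
    and sub: "col_space A \<subseteq> col_space B" and rank: "rank A = rank B"
  shows "col_space A = col_space B"
proof (rule ccontr)
  assume "col_space A \<noteq> col_space B"
  with sub obtain v where v: "v \<in> col_space B" "v \<notin> col_space A"
    by blast
  obtain U where U: "finite U" "U \<subseteq> set (cols A)" "lin_indpt U" "card U = rank A"
    "span U = col_space A"
    using col_space_basis[OF A] .
  have UA: "U \<subseteq> col_space A"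
    using U(2) cols_subset_col_space[OF A] by blast
  then have Uc: "U \<subseteq> carrier_vec n"
    using col_space_closed[OF A] by blast
  have "v \<in> carrier_vec n"
    using v(1) col_space_closed[OF B] by blast
  then have "lin_indpt (insert v U)"
    using lin_dep_iff_in_span[of U v] Uc U(3,5) v UA by auto
  then have "card (insert v U) \<le> rank B"
    using lin_indpt_card_le_rank[OF B, of "insert v U"] v(1) UA sub by auto
  moreover have "v \<notin> U"
    using v(2) UA by blast
  ultimately show False
    using U(1,4) rank by simp
qed

lemma col_space_mult_subset:
  assumes A: "A \<in> carrier_mat n m" and B: "B \<in> carrier_mat m p"
  shows "col_space (A * B) \<subseteq> col_space A"
proof -
  have AB: "A * B \<in> carrier_mat n p"
    using A B by simp
  show ?thesis
  proof
    fix y assume "y \<in> col_space (A * B)"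
    then obtain x where x: "x \<in> carrier_vec p" "y = (A * B) *\<^sub>v x"
      using col_space_eq[OF AB] B by auto
    then have "y = A *\<^sub>v (B *\<^sub>v x)" "B *\<^sub>v x \<in> carrier_vec m"
      using A B by auto
    then show "y \<in> col_space A"
      using col_space_eq[OF A] A by auto
  qed
qed

text \<open>Each column of \<open>A\<close> is the image under \<open>B\<close> of some vector;
  these vectors are the columns of \<open>C\<close>. This is what turns range inclusions into matrix
  equations.\<close>

lemma col_space_subset_factor:
  assumes A: "A \<in> carrier_mat n p" and B: "B \<in> carrier_mat n m"
    and sub: "col_space A \<subseteq> col_space B"
  obtains C where "C \<in> carrier_mat m p" "A = B * C"
proof -
  have "\<exists>x\<in>carrier_vec m. B *\<^sub>v x = col A j" if "j < p" for j
  proof -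
    have "col A j \<in> set (cols A)"
      using that A by (auto simp: cols_def)
    then have "col A j \<in> col_space B"
      using cols_subset_col_space[OF A] sub by blast
    then show ?thesis
      using col_space_eq[OF B] B by auto
  qed
  then obtain f where f: "\<And>j. j < p \<Longrightarrow> f j \<in> carrier_vec m" "\<And>j. j < p \<Longrightarrow> B *\<^sub>v f j = col A j"
    by metis
  define C where "C = mat_of_cols m (map f [0..<p])"
  have C: "C \<in> carrier_mat m p"
    unfolding C_def using mat_of_cols_carrier(1)[of m "map f [0..<p]"] by simp
  have "A = B * C"
  proof (rule mat_col_eqI)
    fix j assume "j < dim_col (B * C)"
    then have j: "j < p"
      using C by simp
    have "col C j = f j"
      unfolding C_def using j f(1) by (subst col_mat_of_cols) auto
    then show "col A j = col (B * C) j"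
      using col_mult2[OF B C j] f(2)[OF j] by simp
  qed (use A B C in auto)
  with C that show thesis
    by blast
qed

lemma rank_mult_le:
  assumes A: "A \<in> carrier_mat n m" and B: "B \<in> carrier_mat m p"
  shows "rank (A * B) \<le> rank A"
  using rank_mono[OF mult_carrier_mat[OF A B] A col_space_mult_subset[OF A B]] .

text \<open>Equal rank forces the inclusion of the column space of \<open>A * B\<close> in that of
  \<open>A\<close> to be an equality, so \<open>A\<close> factors through
  \<open>A * B\<close>.\<close>

lemma rank_mult_eq_factor:
  assumes A: "A \<in> carrier_mat n m" and B: "B \<in> carrier_mat m p"
    and rank: "rank (A * B) = rank A"
  obtains C where "C \<in> carrier_mat p m" "A = A * B * C"
proof -
  have AB: "A * B \<in> carrier_mat n p"
    using A B by simp
  have "col_space A \<subseteq> col_space (A * B)"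
    using col_space_eqI[OF AB A col_space_mult_subset[OF A B] rank] by simp
  then show thesis
    using col_space_subset_factor[OF A AB] that by blast
qed

text \<open>The columns of \<open>F\<close> are a basis of the column space. The inner dimension
  \<open>rank A\<close> is what bounds the rank of the adjoint below.\<close>

lemma rank_factorization:
  assumes A: "A \<in> carrier_mat n m"
  obtains F C where "F \<in> carrier_mat n (rank A)" "C \<in> carrier_mat (rank A) m" "A = F * C"
proof -
  obtain U where U: "finite U" "U \<subseteq> set (cols A)" "card U = rank A" "span U = col_space A"
    using col_space_basis[OF A] .
  obtain us where us: "set us = U" "distinct us"
    using finite_distinct_list[OF U(1)] by blast
  have len: "length us = rank A"
    using us U(3) distinct_card by fastforce
  define F where "F = mat_of_cols n us"
  have F: "F \<in> carrier_mat n (rank A)"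
    unfolding F_def using mat_of_cols_carrier(1)[of n us] len by simp
  have "set us \<subseteq> carrier_vec n"
    using us U(2) cols_dim[of A] A by auto
  then have "cols F = us"
    unfolding F_def by (rule cols_mat_of_cols)
  then have "col_space A \<subseteq> col_space F"
    using U(4) us by (simp add: col_space_def)
  then show thesis
    using col_space_subset_factor[OF A F] F that by blast
qed

end


section \<open>Conjugate transposes and their rank\<close>

lemma index_mat_adjoint:
  assumes "i < dim_col A" "j < dim_row A"
  shows "mat_adjoint A $$ (i, j) = conjugate (A $$ (j, i))"
  using assms unfolding mat_adjoint_def by (simp add: mat_of_rows_index)

lemma dim_mat_adjoint [simp]:
  "dim_row (mat_adjoint A) = dim_col A" "dim_col (mat_adjoint A) = dim_row A"
  unfolding mat_adjoint_def by auto

lemma mat_adjoint_carrier [simp]: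
  "A \<in> carrier_mat m p \<Longrightarrow> mat_adjoint A \<in> carrier_mat p m"
  by auto

lemma mat_adjoint_mat_adjoint [simp]: "mat_adjoint (mat_adjoint A) = A"
  by (rule eq_matI) (auto simp: index_mat_adjoint)

lemma mat_adjoint_mult:
  fixes A B :: "complex mat"
  assumes "A \<in> carrier_mat m p" "B \<in> carrier_mat p q"
  shows "mat_adjoint (A * B) = mat_adjoint B * mat_adjoint A"
  using assms
  by (intro eq_matI) (auto simp: index_mat_adjoint scalar_prod_def mult.commute intro!: sum.cong)

text \<open>Taking adjoints in a rank factorization \<open>A = F * C\<close> makes
  \<open>mat_adjoint C\<close> the left factor, and it has only \<open>rk n A\<close>
  columns.\<close>

lemma rank_mat_adjoint_le:
  assumes A: "A \<in> carrier_mat n n"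
  shows "rk n (mat_adjoint A) \<le> rk n A"
proof -
  obtain F C where F: "F \<in> carrier_mat n (rk n A)" and C: "C \<in> carrier_mat (rk n A) n"
    and AFC: "A = F * C"
    using vec_space.rank_factorization[OF A] .
  have "rk n (mat_adjoint C * mat_adjoint F) \<le> rk n (mat_adjoint C)"
    using F C by (intro vec_space.rank_mult_le) auto
  also have "\<dots> \<le> rk n A"
    using C by (intro vec_space.rank_le_nc) auto
  finally show ?thesis
    using mat_adjoint_mult[OF F C] AFC by simp
qed

lemma rank_mat_adjoint:
  assumes "A \<in> carrier_mat n n"
  shows "rk n (mat_adjoint A) = rk n A"
  using rank_mat_adjoint_le[OF assms] rank_mat_adjoint_le[of "mat_adjoint A" n] assms by simp

text \<open>The mirror image of \<open>rank_mult_eq_factor\<close>: conjugate transposition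
  preserves the rank and swaps left and right factors.\<close>

lemma rank_mult_left_eq_factor:
  assumes A: "A \<in> carrier_mat n n" and B: "B \<in> carrier_mat n n"
    and rank: "rk n (B * A) = rk n A"
  obtains C where "C \<in> carrier_mat n n" "A = C * (B * A)"
proof -
  have "rk n (mat_adjoint A * mat_adjoint B) = rk n (mat_adjoint A)"
    using rank A B by (simp add: rank_mat_adjoint flip: mat_adjoint_mult)
  then obtain D where D: "D \<in> carrier_mat n n"
    and eq: "mat_adjoint A = mat_adjoint A * mat_adjoint B * D"
    using A B vec_space.rank_mult_eq_factor[of "mat_adjoint A" n n "mat_adjoint B" n] by auto
  have "mat_adjoint (mat_adjoint A) = mat_adjoint (mat_adjoint A * mat_adjoint B * D)"
    using eq by simp
  also have "\<dots> = mat_adjoint D * (B * A)"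
    using A B D by (simp add: mat_adjoint_mult[of _ n n _ n] mult_carrier_mat[of _ n n _ n])
  finally show thesis
    using that[of "mat_adjoint D"] D by simp
qed

section \<open>The Minkowski metric and the Minkowski adjoint\<close>

lemma minkowski_metric_carrier [simp]: "minkowski_metric n \<in> carrier_mat n n"
  unfolding minkowski_metric_def by simp

lemma mat_adjoint_minkowski_metric: "mat_adjoint (minkowski_metric n) = minkowski_metric n"
  by (rule eq_matI) (auto simp: index_mat_adjoint minkowski_metric_def)

lemma minkowski_metric_square: "minkowski_metric n * minkowski_metric n = 1\<^sub>m n"
proof (rule eq_matI)
  fix i j assume "i < dim_row (1\<^sub>m n :: complex mat)" "j < dim_col (1\<^sub>m n :: complex mat)"
  then have ij: "i < n" "j < n"
    by auto
  let ?g = "\<lambda>i. if i = 0 then 1 else - 1 :: complex"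
  have "(minkowski_metric n * minkowski_metric n) $$ (i, j) =
      (\<Sum>l<n. (if i = l then ?g i else 0) * (if l = j then ?g l else 0))"
    using ij by (simp add: minkowski_metric_def scalar_prod_def lessThan_atLeast0)
  also have "\<dots> = (\<Sum>l<n. if l = i then ?g i * (if i = j then ?g i else 0) else 0)"
    by (rule sum.cong) auto
  also have "\<dots> = 1\<^sub>m n $$ (i, j)"
    using ij by simp
  finally show "(minkowski_metric n * minkowski_metric n) $$ (i, j) = 1\<^sub>m n $$ (i, j)" .
qed (auto simp: minkowski_metric_def)

lemma minkowski_adjoint_carrier [simp]:
  "A \<in> carrier_mat n n \<Longrightarrow> minkowski_adjoint n A \<in> carrier_mat n n"
  unfolding minkowski_adjoint_def by (intro mult_carrier_mat[of _ n n]) auto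

text \<open>The right-nested form lets two adjacent metrics cancel after products have been
  reassociated to the right by \<open>assoc_mult_mat\<close>.\<close>

lemma minkowski_metric_cancel:
  assumes "A \<in> carrier_mat n n"
  shows "minkowski_metric n * (minkowski_metric n * A) = A"
proof -
  have "minkowski_metric n * (minkowski_metric n * A) = minkowski_metric n * minkowski_metric n * A"
    using assms by (simp add: assoc_mult_mat[of _ n n _ n _ n])
  then show ?thesis
    using assms by (simp add: minkowski_metric_square)
qed

lemma minkowski_adjoint_mult:
  assumes "A \<in> carrier_mat n n" "B \<in> carrier_mat n n"
  shows "minkowski_adjoint n (A * B) = minkowski_adjoint n B * minkowski_adjoint n A"
  using assms
  by (simp add: minkowski_adjoint_def mat_adjoint_mult[of _ n n _ n] minkowski_metric_cancel
      assoc_mult_mat[of _ n n _ n _ n] mult_carrier_mat[of _ n n _ n])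

lemma minkowski_adjoint_minkowski_adjoint:
  assumes "A \<in> carrier_mat n n"
  shows "minkowski_adjoint n (minkowski_adjoint n A) = A"
  using assms
  by (simp add: minkowski_adjoint_def mat_adjoint_mult[of _ n n _ n] minkowski_metric_cancel
      mat_adjoint_minkowski_metric minkowski_metric_square
      assoc_mult_mat[of _ n n _ n _ n] mult_carrier_mat[of _ n n _ n])

section \<open>Powers and the index\<close>

lemma pow_mat_commute:
  assumes "A \<in> carrier_mat n n"
  shows "A * A ^\<^sub>m k = A ^\<^sub>m k * A"
proof (induction k)
  case (Suc k)
  have "A * (A ^\<^sub>m k * A) = A * A ^\<^sub>m k * A"
    using assms by (simp add: assoc_mult_mat[of _ n n _ n _ n])
  with Suc show ?case
    by simp
qed (use assms in simp)

lemma rank_pow_mat_index: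
  assumes A: "A \<in> carrier_mat n n"
  shows "rk n (A ^\<^sub>m (mat_index n A + 1)) = rk n (A ^\<^sub>m mat_index n A)"
proof -
  \<comment> \<open>The \<open>LEAST\<close> in \<open>mat_index\<close> needs a witness. An
    exponent with minimal rank among all positive ones is one, because the next power cannot have
    larger rank.\<close>
  obtain k where k: "k \<ge> 1" and min: "\<And>j. j \<ge> 1 \<Longrightarrow> rk n (A ^\<^sub>m k) \<le> rk n (A ^\<^sub>m j)"
    using ex_has_least_nat[of "\<lambda>j::nat. j \<ge> 1" 1 "\<lambda>j. rk n (A ^\<^sub>m j)"] by auto
  have "rk n (A ^\<^sub>m (k + 1)) \<le> rk n (A ^\<^sub>m k)"
    using vec_space.rank_mult_le[of "A ^\<^sub>m k" n n A n] A by simp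
  with min[of "k + 1"] k have "\<exists>k. 1 \<le> k \<and> rk n (A ^\<^sub>m (k + 1)) = rk n (A ^\<^sub>m k)"
    by (auto intro: antisym)
  then show ?thesis
    unfolding mat_index_def by (metis (mono_tags, lifting) LeastI_ex)
qed

text \<open>At the index, multiplying \<open>P\<close> by \<open>A\<close> loses no rank, and
  \<open>A\<close> commutes with \<open>P\<close>, so \<open>P\<close> is recovered from
  \<open>A * P\<close> on either side. \<open>W\<close> serves to cancel \<open>A\<close> on the
  range of \<open>P\<close>, while \<open>Z\<close> places \<open>P\<close> in the range of
  \<open>A * P\<close>.\<close>

lemma mat_index_factors:
  assumes A: "A \<in> carrier_mat n n"
  defines "P \<equiv> A ^\<^sub>m mat_index n A"
  obtains W Z where "W \<in> carrier_mat n n" "Z \<in> carrier_mat n n"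
    "P = W * (A * P)" "P = A * P * Z"
proof -
  have P: "P \<in> carrier_mat n n"
    using A by (simp add: P_def)
  have rank: "rk n (P * A) = rk n P"
    using rank_pow_mat_index[OF A] by (simp add: P_def)
  have comm: "A * P = P * A"
    unfolding P_def by (rule pow_mat_commute[OF A])
  obtain W where "W \<in> carrier_mat n n" "P = W * (A * P)"
    using rank_mult_left_eq_factor[OF P A] rank comm by auto
  moreover obtain Z where "Z \<in> carrier_mat n n" "P = A * P * Z"
    using vec_space.rank_mult_eq_factor[OF P A rank] comm by auto
  ultimately show thesis
    using that by blast
qed

section \<open>Properties, uniqueness and existence of the m-core-EP inverse\<close>

lemma m_core_EP_inverseD:
  assumes A: "A \<in> carrier_mat n n" and X: "is_m_core_EP_inverse n A X"
  defines "P \<equiv> A ^\<^sub>m mat_index n A"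
  shows "X \<in> carrier_mat n n" "X * A * X = X" "X * (A * P) = P"
    "minkowski_adjoint n (A * X) = A * X" "\<exists>Y\<in>carrier_mat n n. X = P * Y" "A * X * P = P"
proof -
  note assoc = assoc_mult_mat[of _ n n _ n _ n]
  have P: "P \<in> carrier_mat n n"
    using A by (simp add: P_def)
  show Xc: "X \<in> carrier_mat n n" and "X * A * X = X"
    and "minkowski_adjoint n (A * X) = A * X"
    using X by (auto simp: is_m_core_EP_inverse_def)
  show XAP: "X * (A * P) = P"
    using X A by (simp add: is_m_core_EP_inverse_def P_def pow_mat_commute)
  show "\<exists>Y\<in>carrier_mat n n. X = P * Y"
    using X vec_space.col_space_subset_factor[OF Xc P]
    by (auto simp: is_m_core_EP_inverse_def P_def)
  obtain Z where Z: "Z \<in> carrier_mat n n" "P = A * P * Z"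
    using mat_index_factors[OF A] unfolding P_def by blast
  \<comment> \<open>Only this occurrence of \<open>P\<close> is expanded, which brings
    \<open>X\<close> next to \<open>A * P\<close>. Plain rewriting with \<open>Z(2)\<close> would
    loop, since \<open>P\<close> recurs on its right-hand side.\<close>
  have "A * X * P = A * X * (A * P * Z)"
    by (rule arg_cong[OF Z(2)])
  also have "\<dots> = A * (X * (A * P)) * Z"
    using A P Z(1) Xc by (simp add: assoc mult_carrier_mat[of _ n n _ n])
  also have "\<dots> = P"
    by (simp only: XAP Z(2)[symmetric])
  finally show "A * X * P = P" .
qed

text \<open>The products \<open>A X\<close> of \<open>A\<close> with its inverses are self-adjoint idempotents with the same range
  as the power of \<open>A\<close>, so they coincide; and \<open>A\<close> can be cancelled on that range.\<close>

lemma m_core_EP_inverse_unique: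
  assumes A: "A \<in> carrier_mat n n"
    and "is_m_core_EP_inverse n A X" "is_m_core_EP_inverse n A X'"
  shows "X = X'"
proof -
  note assoc = assoc_mult_mat[of _ n n _ n _ n]
  define P where "P = A ^\<^sub>m mat_index n A"
  have P: "P \<in> carrier_mat n n"
    using A by (simp add: P_def)
  note X = m_core_EP_inverseD[OF A assms(2), folded P_def]
    and X' = m_core_EP_inverseD[OF A assms(3), folded P_def]
  obtain W where W: "W \<in> carrier_mat n n" "P = W * (A * P)"
    using mat_index_factors[OF A] unfolding P_def by blast
  have comm: "A * P = P * A"
    unfolding P_def by (rule pow_mat_commute[OF A])
  \<comment> \<open>As \<open>A\<close> commutes with \<open>P\<close>, the product
    \<open>A * V\<close> again starts with \<open>P\<close>, and \<open>A * U\<close> fixes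
    \<open>P\<close>.\<close>
  have absorb: "A * U * (A * V) = A * V"
    if U: "U \<in> carrier_mat n n" "A * U * P = P" and V: "\<exists>Y\<in>carrier_mat n n. V = P * Y" for U V
  proof -
    obtain Y where Y: "Y \<in> carrier_mat n n" "V = P * Y"
      using V by blast
    have "A * V = A * P * Y"
      using A P Y by (simp add: assoc)
    then have AV: "A * V = P * (A * Y)"
      unfolding comm using A P Y(1) by (simp add: assoc)
    have "A * U * (A * V) = A * U * P * (A * Y)"
      unfolding AV using A P Y(1) U(1) by (simp add: assoc mult_carrier_mat[of _ n n _ n])
    then show ?thesis
      by (simp only: U(2) AV)
  qed
  \<comment> \<open>Both products are self-adjoint, so the adjoint merely swaps them; the opposite
    absorption then leaves \<open>A * X'\<close>.\<close>
  have "A * X = minkowski_adjoint n (A * X' * (A * X))"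
    using absorb[OF X'(1,6) X(5)] X(4) by simp
  also have "\<dots> = A * X * (A * X')"
    using X X' A by (simp add: minkowski_adjoint_mult mult_carrier_mat[of _ n n _ n])
  also have "\<dots> = A * X'"
    using absorb[OF X(1,6) X'(5)] .
  finally have AX: "A * X = A * X'" .
  have cancel: "W * (A * V) = V" if V: "\<exists>Y\<in>carrier_mat n n. V = P * Y" for V
  proof -
    obtain Y where Y: "Y \<in> carrier_mat n n" "V = P * Y"
      using V by blast
    have "W * (A * V) = W * (A * P) * Y"
      using A P Y(1) W(1) unfolding Y(2) by (simp add: assoc mult_carrier_mat[of _ n n _ n])
    then show ?thesis
      using W(2)[symmetric] Y by simp
  qed
  show ?thesis
    using cancel[OF X(5)] cancel[OF X'(5)] AX by metis
qed

lemma m_core_EP_inverse_exists: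
  assumes A: "A \<in> carrier_mat n n" and rank: "m_core_EP_rank_cond n A"
  shows "\<exists>X. is_m_core_EP_inverse n A X"
proof -
  note assoc = assoc_mult_mat[of _ n n _ n _ n] mult_carrier_mat[of _ n n _ n]
  define P where "P = A ^\<^sub>m mat_index n A"
  let ?adj = "minkowski_adjoint n"
  have P: "P \<in> carrier_mat n n"
    using A by (simp add: P_def)
  \<comment> \<open>The rank condition says that left multiplication of \<open>P\<close> by its
    Minkowski adjoint keeps the rank, so \<open>P\<close> can be recovered by a left factor.\<close>
  obtain M where M: "M \<in> carrier_mat n n" "P = M * (?adj P * P)"
    using rank_mult_left_eq_factor[of P n "?adj P"] P rank
    unfolding m_core_EP_rank_cond_def P_def by auto
  obtain W Z where W: "W \<in> carrier_mat n n" "P = W * (A * P)"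
    and Z: "Z \<in> carrier_mat n n" "P = A * P * Z"
    using mat_index_factors[OF A] unfolding P_def by metis
  note carr = A P M(1) W(1) Z(1)
  have comm: "A * P = P * A"
    unfolding P_def by (rule pow_mat_commute[OF A])
  \<comment> \<open>The orthogonal projector onto the range of \<open>P\<close>.\<close>
  define Q where "Q = M * ?adj P"
  have Q: "Q \<in> carrier_mat n n"
    unfolding Q_def using carr by (intro mult_carrier_mat[of _ n n]) auto
  have QP: "Q * P = P"
    unfolding Q_def using M(2)[symmetric] carr by (simp add: assoc)
  have adjQ: "?adj Q = P * ?adj M"
    unfolding Q_def using carr by (simp add: minkowski_adjoint_mult minkowski_adjoint_minkowski_adjoint)
  \<comment> \<open>The adjoint of \<open>Q * P = P\<close>, multiplied by \<open>M\<close> on the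
    left, gives this. The right-hand side is visibly self-adjoint, hence so is \<open>Q\<close>,
    which makes \<open>Q\<close> idempotent as well.\<close>
  have "Q = Q * ?adj Q"
  proof -
    have "?adj P = ?adj P * ?adj Q"
      using QP Q P by (metis minkowski_adjoint_mult)
    then have "M * ?adj P = M * ?adj P * ?adj Q"
      using carr Q by (metis assoc(1) minkowski_adjoint_carrier)
    then show ?thesis
      unfolding Q_def .
  qed
  then have Q_self: "?adj Q = Q"
    using Q by (metis minkowski_adjoint_mult minkowski_adjoint_minkowski_adjoint minkowski_adjoint_carrier)
  have QPM: "Q = P * ?adj M"
    using adjQ Q_self by simp
  \<comment> \<open>The leading \<open>P\<close> gives the range inclusion, and
    \<open>A * P * Z = P\<close> makes \<open>A * X\<close> equal to \<open>P * ?adj M\<close>,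
    which is \<open>Q\<close>.\<close>
  define X where "X = P * (Z * ?adj M)"
  have Xc: "X \<in> carrier_mat n n"
    unfolding X_def using carr by (simp add: assoc)
  have AX: "A * X = Q"
  proof -
    have "A * X = A * P * Z * ?adj M"
      unfolding X_def using carr by (simp add: assoc)
    then show ?thesis
      using Z(2)[symmetric] QPM by simp
  qed
  \<comment> \<open>\<open>W\<close> undoes \<open>A\<close> on the range of \<open>P\<close>. The
    remaining identities for \<open>X\<close> can therefore be checked after multiplication by
    \<open>A\<close>, where \<open>A * X\<close> becomes the projector \<open>Q\<close>.\<close>
  have cancel: "W * (A * (P * Y)) = P * Y" if "Y \<in> carrier_mat n n" for Y
  proof -
    have "W * (A * (P * Y)) = W * (A * P) * Y"
      using carr that by (simp add: assoc)
    then show ?thesis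
      using W(2)[symmetric] by simp
  qed
  have cancel_X: "W * (A * (X * Y)) = X * Y" if "Y \<in> carrier_mat n n" for Y
    using cancel[of "Z * ?adj M * Y"] that carr unfolding X_def by (simp add: assoc)
  have "X * (A * P) = W * (A * (X * (A * P)))"
    using cancel_X[of "A * P"] carr by simp
  also have "\<dots> = W * (A * X * P * A)"
    using carr Xc comm by (simp add: assoc)
  also have "\<dots> = P"
    by (simp only: AX QP comm[symmetric] W(2)[symmetric])
  finally have XAP: "X * (A * P) = P" .
  have "X * A * X = W * (A * (X * (A * X)))"
    using cancel_X[of "A * X"] carr Xc by (simp add: assoc)
  also have "\<dots> = W * (Q * Q)"
    using carr Xc by (simp add: assoc flip: AX)
  also have "Q * Q = Q"
    using \<open>Q = Q * ?adj Q\<close>[symmetric] Q_self by simp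
  also have "W * Q = X"
    using cancel[of "Z * ?adj M"] carr AX by (simp add: X_def)
  finally have "X * A * X = X" .
  moreover have "col_range n X \<subseteq> col_range n P"
    unfolding X_def using carr by (intro vec_space.col_space_mult_subset) (auto simp: assoc)
  ultimately have "is_m_core_EP_inverse n A X"
    unfolding is_m_core_EP_inverse_def using Xc XAP AX Q_self comm by (simp add: P_def)
  then show ?thesis ..
qed

lemma is_m_core_EP_inverse_m_core_EP_inverse:
  assumes "A \<in> carrier_mat n n" "m_core_EP_rank_cond n A"
  shows "is_m_core_EP_inverse n A (m_core_EP_inverse n A)"
  unfolding m_core_EP_inverse_def
  using m_core_EP_inverse_exists[OF assms] m_core_EP_inverse_unique[OF assms(1)] by (metis theI)

section \<open>Characterization of the m-core-EP order\<close>

theorem theorem4p3: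
  fixes n k t r s :: nat and A B :: "complex mat"
  assumes "n \<ge> 1"
    and "A \<in> carrier_mat n n" and "B \<in> carrier_mat n n"
    and "mat_index n A = k" and "mat_index n B = t"
    and "rk n (A ^\<^sub>m k) = r"
    and "rk n (minkowski_adjoint n (A ^\<^sub>m k) * A ^\<^sub>m k) = r"
    and "rk n (B ^\<^sub>m t) = s"
    and "rk n (minkowski_adjoint n (B ^\<^sub>m t) * B ^\<^sub>m t) = s"
    and "s \<ge> r"
  shows "m_core_EP_le n A B \<longleftrightarrow>
    A ^\<^sub>m (k + 1) = B * A ^\<^sub>m k \<and>
    minkowski_adjoint n A * A ^\<^sub>m k = minkowski_adjoint n B * A ^\<^sub>m k"
proof -
  note assoc = assoc_mult_mat[of _ n n _ n _ n] mult_carrier_mat[of _ n n _ n]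
  note A = assms(2) and B = assms(3)
  let ?adj = "minkowski_adjoint n"
  define P where "P = A ^\<^sub>m k"
  define X where "X = m_core_EP_inverse n A"
  have cond: "m_core_EP_rank_cond n A"
    unfolding m_core_EP_rank_cond_def using assms(4,6,7) by simp
  have inv: "is_m_core_EP_inverse n A X"
    unfolding X_def using A cond by (rule is_m_core_EP_inverse_m_core_EP_inverse)
  note X = m_core_EP_inverseD[OF A inv, unfolded assms(4), folded P_def]
  have P: "P \<in> carrier_mat n n"
    using A by (simp add: P_def)
  note carr = A B P X(1)
  have comm: "A * P = P * A"
    unfolding P_def by (rule pow_mat_commute[OF A])
  \<comment> \<open>Since \<open>A * X\<close> is self-adjoint, taking adjoints moves it from the
    left of \<open>C\<close> to the right of \<open>?adj C\<close>.\<close>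
  have adj_AX: "?adj (A * X * C) = ?adj C * (A * X)" if "C \<in> carrier_mat n n" for C
    using minkowski_adjoint_mult[OF mult_carrier_mat[OF A X(1)] that] by (simp only: X(4))
  have "(X * A = X * B \<and> A * X = B * X) \<longleftrightarrow> (A * P = B * P \<and> ?adj A * P = ?adj B * P)"
  proof safe
    assume XAB: "X * A = X * B" and AXB: "A * X = B * X"
    have "A * P = A * X * (A * P)"
      using X(3) carr by (simp add: assoc)
    also have "\<dots> = B * (X * (A * P))"
      unfolding AXB using carr by (simp add: assoc)
    finally show "A * P = B * P"
      using X(3) by simp
    \<comment> \<open>Multiplying \<open>X * A = X * B\<close> by \<open>A\<close> produces the
      self-adjoint factor \<open>A * X\<close>; after taking adjoints, \<open>A * X * P = P\<close>
      removes \<open>X\<close>.\<close>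
    have "A * X * A = A * X * B"
      using XAB carr by (simp add: assoc)
    then have eq: "?adj A * (A * X) = ?adj B * (A * X)"
      using adj_AX[OF A] adj_AX[OF B] by simp
    have "?adj A * P = ?adj A * (A * X) * P"
      using carr X(6) by (simp add: assoc)
    also have "\<dots> = ?adj B * P"
      unfolding eq using carr X(6) by (simp add: assoc)
    finally show "?adj A * P = ?adj B * P" .
  next
    assume AP: "A * P = B * P" and adjP: "?adj A * P = ?adj B * P"
    obtain Y where Y: "Y \<in> carrier_mat n n" "X = P * Y"
      using X(5) by blast
    have APY: "A * X = A * P * Y"
      unfolding Y(2) using Y(1) carr by (simp add: assoc)
    also have "\<dots> = B * X"
      unfolding AP Y(2) using Y(1) carr by (simp add: assoc)
    finally show "A * X = B * X" .
    \<comment> \<open>With \<open>P\<close> in front, the hypothesis on \<open>?adj A * P\<close>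
      applies directly to \<open>?adj A * (A * X)\<close>.\<close>
    have AX: "A * X = P * (A * Y)"
      unfolding APY comm using Y(1) carr by (simp add: assoc)
    have "?adj A * (A * X) = ?adj A * P * (A * Y)"
      unfolding AX using Y(1) carr by (simp add: assoc)
    also have "\<dots> = ?adj B * (A * X)"
      unfolding AX adjP using Y(1) carr by (simp add: assoc)
    finally have "?adj (A * X * A) = ?adj (A * X * B)"
      using adj_AX[OF A] adj_AX[OF B] by simp
    \<comment> \<open>The Minkowski adjoint is an involution, hence injective.\<close>
    then have eq: "A * X * A = A * X * B"
      using carr by (metis minkowski_adjoint_minkowski_adjoint assoc(2))
    have "X * A = X * A * X * A"
      using X(2) by simp
    also have "\<dots> = X * (A * X * A)"
      using carr by (simp add: assoc)
    also have "\<dots> = X * A * X * B"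
      unfolding eq using carr by (simp add: assoc)
    finally show "X * A = X * B"
      using X(2) by simp
  qed
  \<comment> \<open>The power \<open>A ^\<^sub>m (k + 1)\<close> unfolds to \<open>P * A\<close>,
    and \<open>comm\<close> matches it with \<open>A * P\<close>.\<close>
  then show ?thesis
    unfolding m_core_EP_le_def using A B cond comm by (simp add: P_def X_def)
qed

end
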